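(* There exists a constant $c>0$ such that for all $n\in\mathbb{N}$, $\varepsilon\in(0,1/2]$, and $t$ satisfying $t\log^2 t\le c\cdot\varepsilon^{2.5}2^{n/2}$, there exists an $\varepsilon$-tester for linearity of functions $f:\{0,1\}^n\to\{0,1\}$ that works in the presence of a $t$-online erasure (or corruption) budget-managing adversary and makes $O(\max\{1/\varepsilon,\log t\})$ queries. In the case of an erasure adversary, the tester has 1-sided error.
   Context: $\log$ is base 2; $t>0$ is the rate of erasures (or corruptions) per query. A function $f:\{0,1\}^n\to\{0,1\}$ is linear if $f(x)+f(y)=f(x\oplus y)$ (addition mod 2, $\oplus$ bitwise XOR) for all $x,y\in\{0,1\}^n$. Online model. The input is a function $f$ on a finite domain. Access is via a sequence of oracles $\mathcal{O}_1,\mathcal{O}_2,\dots$, where $\mathcal{O}_i$ answers the $i$-th query and $\mathcal{O}_1=f$. After each query the adversary chooses the next oracle; its strategy may depend on the input, the tester's description, and all queries made so far, but not on the tester's future coin tosses. Let $\mathrm{Dist}$ denote Hamming distance (number of points with different answers). A $t$-online budget-managing adversary must satisfy $\mathrm{Dist}(\mathcal{O}_1,\mathcal{O}_{i+1})\le i\cdot t$ for all $i\in\mathbb{N}$. An erasure adversary must satisfy $\mathcal{O}_{i+1}(x)\in\{\mathcal{O}_i(x),\perp\}$ for all $x$ ($\perp$ is the erasure symbol); a corruption adversary may change values arbitrarily within the range. $f$ is $\varepsilon$-far from a property $\mathcal{P}$ (a set of functions) if at least an $\varepsilon$ fraction of the values of $f$ must be changed to obtain a function in $\mathcal{P}$.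 An (online) $\varepsilon$-tester for $\mathcal{P}$ working in the presence of a given type of adversary is a randomized algorithm that, for every adversarial strategy of that type, accepts with probability at least $2/3$ if $f\in\mathcal{P}$ and rejects with probability at least $2/3$ if $f$ is $\varepsilon$-far from $\mathcal{P}$. It has 1-sided error if it always accepts every $f\in\mathcal{P}$.
   Formalization: The bound t ≤ c·ε^2.5·2^(n/2) is assumed in addition to t·log²t ≤ c·ε^2.5·2^(n/2); it matters only for 1/2 < t < 2. Without it the claim fails: t=1, n=2, ε=1/4, f the indicator of 11, where erasing one point after the first query defeats any 1-sided tester. *)

theory Defs
  imports "HOL-Probability.Probability" "HOL-Library.Z2"
begin

section \<open>Functions on a finite domain\<close>

text \<open>
  A function on a finite domain is a HOL function together with a set \<open>X\<close>; its values outside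
  \<open>X\<close> play no role. Online oracles answer \<open>None\<close> at erased points.
\<close>

type_synonym ('q, 'a) online_oracle = "'q \<Rightarrow> 'a option"

definition hamming_dist :: "'q set \<Rightarrow> ('q \<Rightarrow> 'v) \<Rightarrow> ('q \<Rightarrow> 'v) \<Rightarrow> nat" where
  "hamming_dist X u v = card {x \<in> X. u x \<noteq> v x}"

definition far_from :: "'q set \<Rightarrow> real \<Rightarrow> ('q \<Rightarrow> 'a) set \<Rightarrow> ('q \<Rightarrow> 'a) \<Rightarrow> bool" where
  "far_from X \<epsilon> P f \<longleftrightarrow> (\<forall>g\<in>P. \<epsilon> * real (card X) \<le> real (hamming_dist X f g))"

section \<open>Online adversaries\<close>

text \<open>
  A strategy maps the list \<open>[x\<^sub>1, \<dots>, x\<^sub>i]\<close> of the queries made so far to the map \<open>O\<^sub>i\<^sub>+\<^sub>1\<close> that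
  answers the next query; in particular \<open>O\<^sub>1\<close> is its value at the empty list. Past answers are
  determined by the strategy and the past queries, so they need not be passed as an argument.
\<close>

type_synonym ('q, 'a) strategy = "'q list \<Rightarrow> ('q, 'a) online_oracle"

definition starts_with :: "'q set \<Rightarrow> ('q \<Rightarrow> 'a) \<Rightarrow> ('q, 'a) strategy \<Rightarrow> bool" where
  "starts_with X f \<sigma> \<longleftrightarrow> (\<forall>x\<in>X. \<sigma> [] x = Some (f x))"

definition budget_managing :: "'q set \<Rightarrow> real \<Rightarrow> ('q, 'a) strategy \<Rightarrow> bool" where
  "budget_managing X t \<sigma> \<longleftrightarrow>
     (\<forall>h\<in>lists X. real (hamming_dist X (\<sigma> []) (\<sigma> h)) \<le> real (length h) * t)"

definition erasure_adversary ::
    "'q set \<Rightarrow> real \<Rightarrow> ('q \<Rightarrow> 'a) \<Rightarrow> ('q, 'a) strategy \<Rightarrow> bool" where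
  "erasure_adversary X t f \<sigma> \<longleftrightarrow>
     starts_with X f \<sigma> \<and> budget_managing X t \<sigma> \<and>
     (\<forall>h\<in>lists X. \<forall>q\<in>X. \<forall>x\<in>X. \<sigma> (h @ [q]) x \<in> {\<sigma> h x, None})"

text \<open>The range of the input is the whole type \<open>'a\<close>.\<close>

definition corruption_adversary ::
    "'q set \<Rightarrow> real \<Rightarrow> ('q \<Rightarrow> 'a) \<Rightarrow> ('q, 'a) strategy \<Rightarrow> bool" where
  "corruption_adversary X t f \<sigma> \<longleftrightarrow>
     starts_with X f \<sigma> \<and> budget_managing X t \<sigma> \<and>
     (\<forall>h\<in>lists X. \<forall>x\<in>X. \<sigma> h x \<noteq> None)"

section \<open>Testers\<close>

text \<open>
  A deterministic adaptive query algorithm is a decision tree whose leaves carry the verdict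
  (\<open>True\<close> for acceptance). A randomized algorithm is a probability distribution on such trees.
  A strategy sees the queries but not the tree that was drawn, so it has no access to coin
  tosses beyond what the queries made so far reveal.
\<close>

datatype (queries: 'q, 'a) algorithm =
    Decide bool
  | Query 'q "'a option \<Rightarrow> ('q, 'a) algorithm"

primrec makes_at_most :: "('q, 'a) algorithm \<Rightarrow> nat \<Rightarrow> bool" where
  "makes_at_most (Decide b) m \<longleftrightarrow> True"
| "makes_at_most (Query x A) m \<longleftrightarrow> 0 < m \<and> (\<forall>a. makes_at_most (A a) (m - 1))"

text \<open>The last argument is the list of queries made so far.\<close>

primrec run_from :: "('q, 'a) algorithm \<Rightarrow> ('q, 'a) strategy \<Rightarrow> 'q list \<Rightarrow> bool" where
  "run_from (Decide b) \<sigma> h = b"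
| "run_from (Query x A) \<sigma> h = run_from (A (\<sigma> h x)) \<sigma> (h @ [x])"

definition accepts :: "('q, 'a) strategy \<Rightarrow> ('q, 'a) algorithm \<Rightarrow> bool" where
  "accepts \<sigma> A \<longleftrightarrow> run_from A \<sigma> []"

text \<open>
  In the next two definitions, \<open>Adv f \<sigma>\<close> says that \<open>\<sigma>\<close> is a strategy of the given type on input
  \<open>f\<close>. The strategy is chosen after the tester and the input, so it may depend on both.
\<close>

definition online_tester ::
    "'q set \<Rightarrow> real \<Rightarrow> ('q \<Rightarrow> 'a) set \<Rightarrow> (('q \<Rightarrow> 'a) \<Rightarrow> ('q, 'a) strategy \<Rightarrow> bool) \<Rightarrow>
     ('q, 'a) algorithm pmf \<Rightarrow> bool" where
  "online_tester X \<epsilon> P Adv T \<longleftrightarrow>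
     (\<forall>A\<in>set_pmf T. queries A \<subseteq> X) \<and>
     (\<forall>f \<sigma>. Adv f \<sigma> \<longrightarrow>
        (f \<in> P \<longrightarrow> measure_pmf.prob T {A. accepts \<sigma> A} \<ge> 2 / 3) \<and>
        (far_from X \<epsilon> P f \<longrightarrow> measure_pmf.prob T {A. \<not> accepts \<sigma> A} \<ge> 2 / 3))"

definition one_sided ::
    "('q \<Rightarrow> 'a) set \<Rightarrow> (('q \<Rightarrow> 'a) \<Rightarrow> ('q, 'a) strategy \<Rightarrow> bool) \<Rightarrow>
     ('q, 'a) algorithm pmf \<Rightarrow> bool" where
  "one_sided P Adv T \<longleftrightarrow>
     (\<forall>f \<sigma>. Adv f \<sigma> \<longrightarrow> f \<in> P \<longrightarrow> (\<forall>A\<in>set_pmf T. accepts \<sigma> A))"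

section \<open>Linearity\<close>

text \<open>The type \<^typ>\<open>bit\<close> is the field with two elements.\<close>

definition cube :: "nat \<Rightarrow> bit list set" where
  "cube n = {x. length x = n}"

definition bitwise_xor :: "bit list \<Rightarrow> bit list \<Rightarrow> bit list" where
  "bitwise_xor x y = map2 (+) x y"

definition linear_functions :: "nat \<Rightarrow> (bit list \<Rightarrow> bit) set" where
  "linear_functions n = {f. \<forall>x\<in>cube n. \<forall>y\<in>cube n. f x + f y = f (bitwise_xor x y)}"

end

theory Submission
  imports Defs
begin

text \<open>
  A block of the tester queries a uniform reserve \<open>x\<^sub>1, \<dots>, x\<^sub>k\<close> and then the sum \<open>y\<close> of an even number
  \<open>r\<close> of its points, and checks that \<open>f y\<close> is the sum of the corresponding values. If nothing queried
  was manipulated, the bias of this check is the sum of the \<open>(r + 1)\<close>-st powers of the Fourier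
  coefficients of \<open>(- 1)\<^sup>f\<close>. These are at most \<open>1 - 2 * \<epsilon>\<close> if \<open>f\<close> is far from linear, so by Parseval the
  bias is at most \<open>(1 - 2 * \<epsilon>) ^ (r - 1)\<close>, which is small once \<open>r\<close> is a multiple of \<open>1 / \<epsilon>\<close>; the block
  then rejects with probability close to \<open>1 / 2\<close>, and two independent blocks suffice.
  The index set is one of \<open>2 ^ m\<close> candidates, where \<open>2 ^ m\<close> is a large multiple of the total budget of
  the adversary but well below \<open>2 ^ (n / 2)\<close>. By a birthday bound the candidate test points are
  distinct, so the adversary cannot spoil a substantial part of them in time.
\<close>

text \<open>Otherwise the simplifier turns arithmetic on bits into Boolean connectives.\<close>

declare add_bit_eq_xor [simp del] mult_bit_eq_and [simp del]

section \<open>Nonadaptive queries\<close>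

primrec ask :: "'q list \<Rightarrow> ('a option list \<Rightarrow> ('q, 'a) algorithm) \<Rightarrow> ('q, 'a) algorithm" where
  "ask [] K = K []"
| "ask (q # qs) K = Query q (\<lambda>a. ask qs (\<lambda>as. K (a # as)))"

primrec answers :: "('q, 'a) strategy \<Rightarrow> 'q list \<Rightarrow> 'q list \<Rightarrow> 'a option list" where
  "answers \<sigma> h [] = []"
| "answers \<sigma> h (q # qs) = \<sigma> h q # answers \<sigma> (h @ [q]) qs"

text \<open>\<open>E h\<close> stands for the set of points manipulated after history
  \<open>h\<close>. Each query is compared with the set in force when it is asked, so spoiling a
  point after it was queried does not count.\<close>

primrec hits :: "('q list \<Rightarrow> 'q set) \<Rightarrow> 'q list \<Rightarrow> 'q list \<Rightarrow> bool" where
  "hits E h [] \<longleftrightarrow> False"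
| "hits E h (q # qs) \<longleftrightarrow> q \<in> E h \<or> hits E (h @ [q]) qs"

lemma run_from_ask: "run_from (ask qs K) \<sigma> h = run_from (K (answers \<sigma> h qs)) \<sigma> (h @ qs)"
  by (induction qs arbitrary: h K) simp_all

lemma queries_ask_subset:
  assumes "\<And>as. queries (K as) \<subseteq> X" "set qs \<subseteq> X"
  shows "queries (ask qs K) \<subseteq> X"
  using assms
proof (induction qs arbitrary: K)
  case (Cons q qs)
  then have "queries (ask qs (\<lambda>as. K (a # as))) \<subseteq> X" for a by simp
  with Cons.prems show ?case by auto
qed simp

lemma makes_at_most_ask:
  assumes "\<And>as. makes_at_most (K as) r"
  shows "makes_at_most (ask qs K) (length qs + r)"
  using assms by (induction qs arbitrary: K) auto

lemma hits_append: "hits E h (qs @ rs) \<longleftrightarrow> hits E h qs \<or> hits E (h @ qs) rs"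
  by (induction qs arbitrary: h) auto

lemma answers_eq_map_Some:
  assumes "\<not> hits (\<lambda>h. {x \<in> X. \<sigma> [] x \<noteq> \<sigma> h x}) h qs" "set qs \<subseteq> X" "starts_with X f \<sigma>"
  shows "answers \<sigma> h qs = map (\<lambda>q. Some (f q)) qs"
  using assms by (induction qs arbitrary: h) (auto simp: starts_with_def)

text \<open>An erasure adversary never lies, which is the source of the 1-sided error: the first
  oracle is \<open>f\<close>, and each step keeps or erases the previous answer.\<close>

lemma erasure_adversary_answer:
  assumes "erasure_adversary X t f \<sigma>" "h \<in> lists X" "x \<in> X"
  shows "\<sigma> h x \<in> {Some (f x), None}"
  using assms(2)
proof (induction h rule: rev_induct)
  case Nil
  then show ?case using assms(1,3) by (simp add: erasure_adversary_def starts_with_def)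
next
  case (snoc q h)
  then have "\<sigma> (h @ [q]) x \<in> {\<sigma> h x, None}"
    using assms(1,3) by (auto simp: erasure_adversary_def)
  then show ?case using snoc by auto
qed

lemma answers_erasure_adversary:
  assumes "erasure_adversary X t f \<sigma>" "h \<in> lists X" "set qs \<subseteq> X" "None \<notin> set (answers \<sigma> h qs)"
  shows "answers \<sigma> h qs = map (\<lambda>q. Some (f q)) qs"
  using assms(2-4)
proof (induction qs arbitrary: h)
  case (Cons q qs)
  have "\<sigma> h q \<in> {Some (f q), None}"
    using erasure_adversary_answer[OF assms(1) Cons.prems(1)] Cons.prems(2) by simp
  then show ?case using Cons by auto
qed simp

section \<open>Tuples and the cube\<close>

definition tuples :: "'a set \<Rightarrow> nat \<Rightarrow> 'a list set" where
  "tuples A k = {xs. set xs \<subseteq> A \<and> length xs = k}"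

lemma tuples_0 [simp]: "tuples A 0 = {[]}"
  by (auto simp: tuples_def)

lemma finite_tuples [simp]: "finite A \<Longrightarrow> finite (tuples A k)"
  by (simp add: tuples_def finite_lists_length_eq)

lemma card_tuples: "finite A \<Longrightarrow> card (tuples A k) = card A ^ k"
  by (simp add: tuples_def card_lists_length_eq)

text \<open>Splits off the first entry; the inductions over uniform tuples and over the cube run
  through this identity.\<close>

lemma sum_tuples_Suc:
  "(\<Sum>xs\<in>tuples A (Suc k). g xs) = (\<Sum>x\<in>A. \<Sum>xs\<in>tuples A k. g (x # xs))"
proof -
  have "(\<Sum>xs\<in>tuples A (Suc k). g xs) = (\<Sum>(x, xs)\<in>A \<times> tuples A k. g (x # xs))"
    by (rule sum.reindex_bij_witness[of _ "\<lambda>(x, xs). x # xs" "\<lambda>xs. (hd xs, tl xs)"])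
      (auto simp: tuples_def length_Suc_conv)
  then show ?thesis by (simp add: sum.cartesian_product)
qed

lemma tuples_UNIV: "tuples UNIV n = cube n"
  by (simp add: tuples_def cube_def)

lemma UNIV_bit_eq: "(UNIV :: bit set) = {0, 1}"
proof -
  have "x \<in> {0, 1}" for x :: bit by (cases x) auto
  then show ?thesis by auto
qed

lemma sum_bit: "(\<Sum>b\<in>UNIV. g b) = g (0::bit) + g 1"
  by (simp add: UNIV_bit_eq)

lemma finite_UNIV_bit: "finite (UNIV :: bit set)"
  by (simp add: UNIV_bit_eq)

lemma finite_cube [simp]: "finite (cube n)"
  using finite_tuples[OF finite_UNIV_bit, of n] by (simp add: tuples_UNIV)

lemma card_cube [simp]: "card (cube n) = 2 ^ n"
proof -
  have "card (UNIV :: bit set) = 2" by (simp add: UNIV_bit_eq)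
  then show ?thesis using card_tuples[OF finite_UNIV_bit, of n] by (simp add: tuples_UNIV)
qed

lemma sum_cube_Suc:
  fixes g :: "bit list \<Rightarrow> 'b::comm_monoid_add"
  shows "(\<Sum>x\<in>cube (Suc n). g x) = (\<Sum>x\<in>cube n. g (0 # x)) + (\<Sum>x\<in>cube n. g (1 # x))"
  using sum_tuples_Suc[of g UNIV n] by (simp add: tuples_UNIV sum_bit)

section \<open>The cube as a vector space over the field with two elements\<close>

abbreviation zeros :: "nat \<Rightarrow> bit list" where
  "zeros n \<equiv> replicate n 0"

lemma zeros_in_cube [simp]: "zeros n \<in> cube n"
  by (simp add: cube_def)

lemma bitwise_xor_Nil [simp]: "bitwise_xor [] y = []"
  by (simp add: bitwise_xor_def)

lemma bitwise_xor_Cons [simp]: "bitwise_xor (a # x) (b # y) = (a + b) # bitwise_xor x y"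
  by (simp add: bitwise_xor_def)

lemma bitwise_xor_in_cube [simp]:
  "x \<in> cube n \<Longrightarrow> y \<in> cube n \<Longrightarrow> bitwise_xor x y \<in> cube n"
  by (simp add: bitwise_xor_def cube_def)

lemma bitwise_xor_commute: "bitwise_xor x y = bitwise_xor y x"
  by (induction x y rule: list_induct2') (auto simp: bitwise_xor_def add.commute)

lemma bitwise_xor_assoc: "bitwise_xor (bitwise_xor x y) z = bitwise_xor x (bitwise_xor y z)"
proof (induction x arbitrary: y z)
  case (Cons a x)
  then show ?case by (cases y; cases z) (auto simp: bitwise_xor_def add.assoc)
qed simp

lemma bitwise_xor_left_commute:
  "bitwise_xor x (bitwise_xor y z) = bitwise_xor y (bitwise_xor x z)"
  by (metis bitwise_xor_assoc bitwise_xor_commute)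

lemma bit_add_self [simp]: "b + b = (0::bit)"
  by (cases b) simp_all

lemma bitwise_xor_self: "x \<in> cube n \<Longrightarrow> bitwise_xor x x = zeros n"
  by (induction x arbitrary: n) (auto simp: cube_def)

lemma bitwise_xor_zeros [simp]:
  assumes "x \<in> cube n" shows "bitwise_xor x (zeros n) = x" "bitwise_xor (zeros n) x = x"
proof -
  show "bitwise_xor x (zeros n) = x"
    using assms by (induction x arbitrary: n) (auto simp: cube_def)
  then show "bitwise_xor (zeros n) x = x" by (simp add: bitwise_xor_commute)
qed

lemma bitwise_xor_cancel:
  assumes "x \<in> cube n" "y \<in> cube n"
  shows "bitwise_xor x (bitwise_xor x y) = y"
  using assms by (simp flip: bitwise_xor_assoc add: bitwise_xor_self)

lemma bitwise_xor_eq_iff: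
  assumes "x \<in> cube n" "y \<in> cube n" "z \<in> cube n"
  shows "bitwise_xor x y = z \<longleftrightarrow> x = bitwise_xor y z"
  using assms by (metis bitwise_xor_cancel bitwise_xor_commute)

section \<open>Fourier analysis on the cube\<close>

definition bsign :: "bit \<Rightarrow> real" where
  "bsign b = (if b = 0 then 1 else - 1)"

lemma bsign_simps [simp]: "bsign 0 = 1" "bsign 1 = - 1"
  by (simp_all add: bsign_def)

lemma bsign_add: "bsign (a + b) = bsign a * bsign b"
  by (cases a; cases b) simp_all

lemma bsign_mult_self [simp]: "bsign a * bsign a = 1"
  by (cases a) simp_all

definition dot :: "bit list \<Rightarrow> bit list \<Rightarrow> bit" where
  "dot a x = sum_list (map2 (*) a x)"

lemma dot_Nil [simp]: "dot [] x = 0"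
  by (simp add: dot_def)

lemma dot_Cons [simp]: "dot (b # a) (y # x) = b * y + dot a x"
  by (simp add: dot_def)

lemma dot_append: "length a = length x \<Longrightarrow> dot (a @ b) (x @ y) = dot a x + dot b y"
  by (simp add: dot_def)

lemma dot_bitwise_xor:
  assumes "a \<in> cube n" "x \<in> cube n" "y \<in> cube n"
  shows "dot a (bitwise_xor x y) = dot a x + dot a y"
  using assms
proof (induction a arbitrary: n x y)
  case (Cons b a)
  then obtain k c x' d y' where "n = Suc k" "x = c # x'" "y = d # y'" "length a = k"
    "length x' = k" "length y' = k"
    by (auto simp: cube_def length_Suc_conv)
  with Cons.IH[of k x' y'] show ?case by (simp add: cube_def algebra_simps)
qed simp

lemma dot_linear: "a \<in> cube n \<Longrightarrow> dot a \<in> linear_functions n"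
  by (simp add: linear_functions_def dot_bitwise_xor)

text \<open>Orthogonality of characters: at a coordinate where \<open>x\<close> is 1, the two
  choices of the corresponding bit of \<open>a\<close> contribute opposite signs and cancel.\<close>

lemma sum_sign_dot:
  assumes "x \<in> cube n"
  shows "(\<Sum>a\<in>cube n. bsign (dot a x)) = (if x = zeros n then 2 ^ n else 0)"
  using assms
proof (induction x arbitrary: n)
  case Nil
  then show ?case by (simp add: cube_def)
next
  case (Cons y x)
  then obtain k where k: "n = Suc k" "x \<in> cube k"
    by (auto simp: cube_def)
  show ?case
    by (cases y) (use k Cons.IH[of k] in \<open>simp_all add: sum_cube_Suc bsign_add sum_negf\<close>)
qed

text \<open>The coefficient of \<open>(- 1) ^ f\<close> at the character indexed by
  \<open>a\<close>: the fraction of points where \<open>f\<close> agrees with \<open>dot a\<close>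
  minus the fraction where it disagrees.\<close>

definition fourier :: "nat \<Rightarrow> (bit list \<Rightarrow> bit) \<Rightarrow> bit list \<Rightarrow> real" where
  "fourier n f a = (\<Sum>x\<in>cube n. bsign (f x) * bsign (dot a x)) / 2 ^ n"

lemma sum_sign_fourier:
  "(\<Sum>x\<in>cube n. bsign (f x) * bsign (dot a x)) = 2 ^ n * fourier n f a"
  by (simp add: fourier_def)

lemma fourier_inversion:
  assumes z: "z \<in> cube n"
  shows "(\<Sum>a\<in>cube n. fourier n f a * bsign (dot a z)) = bsign (f z)"
proof -
  have "(\<Sum>a\<in>cube n. fourier n f a * bsign (dot a z)) =
      (\<Sum>a\<in>cube n. \<Sum>x\<in>cube n. bsign (f x) * bsign (dot a (bitwise_xor x z))) / 2 ^ n"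
    using z by (auto simp: fourier_def sum_divide_distrib sum_distrib_right dot_bitwise_xor
        bsign_add mult.assoc intro!: sum.cong)
  also have "\<dots> = (\<Sum>x\<in>cube n. bsign (f x) * (\<Sum>a\<in>cube n. bsign (dot a (bitwise_xor x z)))) / 2 ^ n"
    by (subst sum.swap) (simp add: sum_distrib_left)
  also have "\<dots> = (\<Sum>x\<in>cube n. bsign (f x) * (if x = z then 2 ^ n else 0)) / 2 ^ n"
    using z by (auto simp: sum_sign_dot bitwise_xor_eq_iff[where n = n]
        intro!: arg_cong2[where f = "(/)"] sum.cong)
  also have "\<dots> = bsign (f z)"
    using z by (simp add: if_distrib sum.delta cong: if_cong)
  finally show ?thesis .
qed

lemma parseval: "(\<Sum>a\<in>cube n. (fourier n f a)\<^sup>2) = 1"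
proof -
  \<comment> \<open>Only one of the two factors is expanded, so that inversion evaluates the sum
    over \<open>a\<close>.\<close>
  have "(\<Sum>a\<in>cube n. (fourier n f a)\<^sup>2) =
      (\<Sum>a\<in>cube n. \<Sum>x\<in>cube n. bsign (f x) * (fourier n f a * bsign (dot a x))) / 2 ^ n"
    by (auto simp: power2_eq_square sum_divide_distrib sum_distrib_left mult_ac
        fourier_def[of n f] intro!: sum.cong)
  also have "\<dots> = (\<Sum>x\<in>cube n. bsign (f x) * (\<Sum>a\<in>cube n. fourier n f a * bsign (dot a x))) / 2 ^ n"
    by (subst sum.swap) (simp add: sum_distrib_left)
  also have "\<dots> = 1"
    by (simp add: fourier_inversion)
  finally show ?thesis .
qed

text \<open>The coefficient is 1 minus twice the fraction of points where \<open>f\<close> differs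
  from \<open>dot a\<close>. The bound is one-sided: the function \<open>dot a\<close> plus 1 is far
  from linear and has a coefficient \<open>- 1\<close>, which is why odd powers are used
  later.\<close>

lemma fourier_far:
  assumes "far_from (cube n) \<epsilon> (linear_functions n) f" "a \<in> cube n"
  shows "fourier n f a \<le> 1 - 2 * \<epsilon>"
proof -
  let ?D = "{x \<in> cube n. f x \<noteq> dot a x}"
  have "bsign (f x) * bsign (dot a x) = 1 - 2 * of_bool (f x \<noteq> dot a x)" for x
    by (cases "f x"; cases "dot a x") simp_all
  then have "(\<Sum>x\<in>cube n. bsign (f x) * bsign (dot a x)) = 2 ^ n - 2 * real (card ?D)"
    by (simp add: sum_subtractf flip: sum_distrib_left) (simp add: of_bool_def sum.If_cases Int_def)
  moreover have "\<epsilon> * 2 ^ n \<le> real (card ?D)"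
    using assms dot_linear[OF assms(2)] by (auto simp: far_from_def hamming_dist_def)
  ultimately show ?thesis
    by (simp add: fourier_def field_simps)
qed

section \<open>Linear combinations\<close>

primrec comb :: "nat \<Rightarrow> bit list \<Rightarrow> bit list list \<Rightarrow> bit list" where
  "comb n [] xs = zeros n"
| "comb n (b # c) xs =
     (if b = 1 then bitwise_xor (hd xs) (comb n c (tl xs)) else comb n c (tl xs))"

definition weight :: "bit list \<Rightarrow> nat" where
  "weight c = length (filter (\<lambda>b. b = 1) c)"

lemma comb_in_cube [simp]:
  assumes "xs \<in> tuples (cube n) (length c)" shows "comb n c xs \<in> cube n"
  using assms by (induction c arbitrary: xs) (auto simp: tuples_def length_Suc_conv)

lemma linear_comb:
  assumes f: "f \<in> linear_functions n" and "xs \<in> tuples (cube n) (length c)"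
  shows "f (comb n c xs) = dot c (map f xs)"
  using assms(2)
proof (induction c arbitrary: xs)
  case Nil
  have "f (zeros n) + f (zeros n) = f (bitwise_xor (zeros n) (zeros n))"
    using f zeros_in_cube unfolding linear_functions_def by blast
  then show ?case by (simp add: bitwise_xor_self)
next
  case (Cons b c)
  then obtain x ys where xs: "xs = x # ys" "x \<in> cube n" and ys: "ys \<in> tuples (cube n) (length c)"
    by (auto simp: tuples_def length_Suc_conv)
  have "f (bitwise_xor x (comb n c ys)) = f x + f (comb n c ys)"
    using f xs(2) comb_in_cube[OF ys] by (simp add: linear_functions_def)
  with xs Cons.IH[OF ys] show ?case by (cases b) simp_all
qed

text \<open>The shift \<open>z\<close> makes the induction on \<open>c\<close> go through. A
  selected point acts as one more convolution with \<open>(- 1) ^ f\<close>, hence one more factor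
  of the Fourier coefficient; an unselected point contributes only a factor
  \<open>2 ^ n\<close>.\<close>

lemma sum_sign_comb:
  assumes "z \<in> cube n"
  shows "(\<Sum>xs\<in>tuples (cube n) (length c).
      bsign (f (bitwise_xor z (comb n c xs))) * bsign (dot c (map f xs))) =
    (2 ^ n) ^ length c * (\<Sum>a\<in>cube n. fourier n f a ^ Suc (weight c) * bsign (dot a z))"
  using assms
proof (induction c arbitrary: z)
  case Nil
  then show ?case by (simp add: weight_def fourier_inversion)
next
  case (Cons b c)
  show ?case
  proof (cases b)
    case zero
    then show ?thesis
      using Cons by (simp add: sum_tuples_Suc weight_def)
  next
    case one
    let ?M = "(2 ^ n) ^ length c :: real"
    have "(\<Sum>xs\<in>tuples (cube n) (length (b # c)).
        bsign (f (bitwise_xor z (comb n (b # c) xs))) * bsign (dot (b # c) (map f xs))) =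
      (\<Sum>x\<in>cube n. bsign (f x) * (\<Sum>xs\<in>tuples (cube n) (length c).
        bsign (f (bitwise_xor (bitwise_xor z x) (comb n c xs))) * bsign (dot c (map f xs))))"
      using one by (simp add: sum_tuples_Suc bsign_add sum_distrib_left mult_ac bitwise_xor_assoc)
    also have "\<dots> = (\<Sum>x\<in>cube n. bsign (f x) * (?M *
        (\<Sum>a\<in>cube n. fourier n f a ^ Suc (weight c) * bsign (dot a (bitwise_xor z x)))))"
      using Cons by simp
    also have "\<dots> = (\<Sum>x\<in>cube n. \<Sum>a\<in>cube n.
        ?M * fourier n f a ^ Suc (weight c) * bsign (dot a z) * (bsign (f x) * bsign (dot a x)))"
      using Cons.prems by (simp add: sum_distrib_left dot_bitwise_xor bsign_add mult_ac)
    \<comment> \<open>Summing over the new point \<open>x\<close> first produces exactly the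
      coefficient at \<open>a\<close>.\<close>
    also have "\<dots> = (\<Sum>a\<in>cube n.
        ?M * fourier n f a ^ Suc (weight c) * bsign (dot a z) * (2 ^ n * fourier n f a))"
      by (subst sum.swap) (simp add: sum_sign_fourier flip: sum_distrib_left)
    also have "\<dots> = (2 ^ n) ^ length (b # c) *
        (\<Sum>a\<in>cube n. fourier n f a ^ Suc (weight (b # c)) * bsign (dot a z))"
      using one by (simp add: weight_def sum_distrib_left mult_ac)
    finally show ?thesis .
  qed
qed

text \<open>Splitting a square off each power leaves, by Parseval, a weighted average of odd powers
  of the coefficients. Negative coefficients then contribute nothing positive, and the others are at
  most \<open>1 - 2 * \<epsilon>\<close>.\<close>

lemma sum_sign_comb_far:
  assumes far: "far_from (cube n) \<epsilon> (linear_functions n) f" and \<epsilon>: "0 < \<epsilon>" "\<epsilon> \<le> 1 / 2"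
    and c: "even (weight c)" "Suc j \<le> weight c"
  shows "(\<Sum>xs\<in>tuples (cube n) (length c). bsign (f (comb n c xs)) * bsign (dot c (map f xs)))
    \<le> (2 ^ n) ^ length c * (1 - 2 * \<epsilon>) ^ j"
proof -
  let ?F = "fourier n f"
  \<comment> \<open>The total exponent is \<open>weight c + 1 = i + 2\<close>, and \<open>i\<close>
    is odd because the weight is even.\<close>
  obtain i where i: "weight c = Suc i" "odd i" "j \<le> i"
    using c by (cases "weight c") auto
  have "(\<Sum>xs\<in>tuples (cube n) (length c). bsign (f (comb n c xs)) * bsign (dot c (map f xs))) =
      (\<Sum>xs\<in>tuples (cube n) (length c).
        bsign (f (bitwise_xor (zeros n) (comb n c xs))) * bsign (dot c (map f xs)))"
    by simp
  also have "\<dots> = (2 ^ n) ^ length c *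
      (\<Sum>a\<in>cube n. ?F a ^ Suc (weight c) * bsign (dot a (zeros n)))"
    by (rule sum_sign_comb) simp
  also have "(\<Sum>a\<in>cube n. ?F a ^ Suc (weight c) * bsign (dot a (zeros n))) =
      (\<Sum>a\<in>cube n. ?F a ^ i * (?F a)\<^sup>2)"
  proof (rule sum.cong)
    fix a assume a: "a \<in> cube n"
    \<comment> \<open>Since \<open>b + b = 0\<close> for every bit, this equation forces
      \<open>dot a (zeros n)\<close> to vanish.\<close>
    then have "dot a (zeros n) + dot a (zeros n) = dot a (zeros n)"
      using dot_bitwise_xor[OF a, of "zeros n" "zeros n"] by (simp add: bitwise_xor_self)
    then show "?F a ^ Suc (weight c) * bsign (dot a (zeros n)) = ?F a ^ i * (?F a)\<^sup>2"
      using i by (simp add: power2_eq_square mult_ac)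
  qed simp
  also have "\<dots> \<le> (\<Sum>a\<in>cube n. (1 - 2 * \<epsilon>) ^ j * (?F a)\<^sup>2)"
  proof (intro sum_mono mult_right_mono)
    fix a assume a: "a \<in> cube n"
    have le: "?F a \<le> 1 - 2 * \<epsilon>" using fourier_far[OF far a] .
    show "?F a ^ i \<le> (1 - 2 * \<epsilon>) ^ j"
    proof (cases "0 \<le> ?F a")
      case True
      then have "?F a ^ i \<le> (1 - 2 * \<epsilon>) ^ i" by (intro power_mono le)
      also have "\<dots> \<le> (1 - 2 * \<epsilon>) ^ j" using \<epsilon> i by (intro power_decreasing) auto
      finally show ?thesis .
    next
      case False
      then have "?F a ^ i \<le> 0" using i by (simp add: power_le_zero_eq odd_pos)
      also have "\<dots> \<le> (1 - 2 * \<epsilon>) ^ j" using \<epsilon> by simp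
      finally show ?thesis .
    qed
  qed simp
  also have "\<dots> = (1 - 2 * \<epsilon>) ^ j"
    by (simp add: parseval flip: sum_distrib_left)
  finally show ?thesis by simp
qed

section \<open>Coincidences between linear combinations of the same reserve\<close>

lemma comb_add:
  assumes "length c = length d" "xs \<in> tuples (cube n) (length c)"
  shows "bitwise_xor (comb n c xs) (comb n d xs) = comb n (bitwise_xor c d) xs"
  using assms
proof (induction c d arbitrary: xs rule: list_induct2)
  case (Cons a c b d)
  then obtain x ys where xs: "xs = x # ys" "x \<in> cube n" and ys: "ys \<in> tuples (cube n) (length c)"
    by (auto simp: tuples_def length_Suc_conv)
  let ?u = "comb n c ys" and ?v = "comb n d ys"
  have IH: "comb n (bitwise_xor c d) ys = bitwise_xor ?u ?v"
    using Cons.IH[OF ys] by simp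
  have uv: "?u \<in> cube n" "?v \<in> cube n"
    using ys Cons.hyps by auto
  \<comment> \<open>If both combinations select \<open>x\<close>, its two copies cancel.\<close>
  have "bitwise_xor (bitwise_xor x ?u) (bitwise_xor x ?v) = bitwise_xor x (bitwise_xor x (bitwise_xor ?u ?v))"
    by (metis bitwise_xor_assoc bitwise_xor_left_commute)
  also have "\<dots> = bitwise_xor ?u ?v"
    using xs(2) uv by (simp add: bitwise_xor_cancel)
  finally have both: "bitwise_xor (bitwise_xor x ?u) (bitwise_xor x ?v) = bitwise_xor ?u ?v" .
  show ?case
    using xs(1) both
    by (cases a; cases b) (simp_all add: IH bitwise_xor_assoc bitwise_xor_left_commute[of ?u x])
qed simp

text \<open>A nonzero combination of independent uniform points is uniform: once the other points
  are fixed, exactly one choice of a selected point yields \<open>z\<close>. The factor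
  \<open>2 ^ n\<close> replaces a division.\<close>

lemma card_comb_eq:
  assumes "c \<noteq> zeros (length c)" "z \<in> cube n"
  shows "2 ^ n * card {xs \<in> tuples (cube n) (length c). comb n c xs = z} = (2 ^ n) ^ length c"
proof -
  have "2 ^ n * (\<Sum>xs\<in>tuples (cube n) (length c). of_bool (comb n c xs = z) :: nat) = (2 ^ n) ^ length c"
    using assms
  proof (induction c)
    case (Cons b c)
    show ?case
    proof (cases b)
      case zero
      with Cons show ?thesis by (simp add: sum_tuples_Suc)
    next
      case one
      have "(\<Sum>x\<in>cube n. of_bool (bitwise_xor x (comb n c xs) = z) :: nat) = 1"
        if "xs \<in> tuples (cube n) (length c)" for xs
      proof -
        have "(\<Sum>x\<in>cube n. of_bool (bitwise_xor x (comb n c xs) = z) :: nat) =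
            (\<Sum>x\<in>cube n. if x = bitwise_xor (comb n c xs) z then 1 else 0)"
          using that \<open>z \<in> cube n\<close> by (intro sum.cong) (auto simp: bitwise_xor_eq_iff[where n = n])
        then show ?thesis using that \<open>z \<in> cube n\<close> by simp
      qed
      then have "(\<Sum>xs\<in>tuples (cube n) (length c).
          \<Sum>x\<in>cube n. of_bool (bitwise_xor x (comb n c xs) = z) :: nat) = (2 ^ n) ^ length c"
        by (simp add: card_tuples)
      then show ?thesis
        using one by (subst (asm) sum.swap) (simp add: sum_tuples_Suc)
    qed
  qed simp
  then show ?thesis by (simp add: of_bool_def sum.If_cases Int_def)
qed

section \<open>One block of queries\<close>

lemma sum_of_bool_card: "finite A \<Longrightarrow> (\<Sum>x\<in>A. of_bool (P x)) = real (card {x \<in> A. P x})"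
  by (simp add: of_bool_def sum.If_cases Int_def)

text \<open>Union bound over the queries: the current set may depend on earlier queries but not on
  the present one, so a uniform query falls into it with probability at most
  \<open>B / card X\<close>. Histories up to length \<open>l\<close> are those for which
  \<open>E\<close> has to be small.\<close>

lemma sum_of_bool_hits_le:
  fixes E :: "'q list \<Rightarrow> 'q set"
  assumes "finite X" and E: "\<And>g. g \<in> lists X \<Longrightarrow> length g \<le> l \<Longrightarrow> real (card (X \<inter> E g)) \<le> B"
    and "h \<in> lists X" "length h + k \<le> l"
  shows "real (card X) * (\<Sum>xs\<in>tuples X k. of_bool (hits E h xs)) \<le> real k * B * real (card X) ^ k"
  using assms(3,4)
proof (induction k arbitrary: h)
  case (Suc k)
  let ?N = "real (card X)"
  have "(\<Sum>xs\<in>tuples X (Suc k). of_bool (hits E h xs)) \<le>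
      (\<Sum>x\<in>X. \<Sum>xs\<in>tuples X k. of_bool (x \<in> E h) + of_bool (hits E (h @ [x]) xs) :: real)"
    unfolding sum_tuples_Suc by (intro sum_mono) auto
  also have "\<dots> = ?N ^ k * real (card (X \<inter> E h)) +
      (\<Sum>x\<in>X. \<Sum>xs\<in>tuples X k. of_bool (hits E (h @ [x]) xs))"
    using \<open>finite X\<close>
    by (simp add: sum.distrib card_tuples sum_of_bool_card Int_def flip: sum_distrib_left)
  also have "\<dots> \<le> ?N ^ k * B + (\<Sum>x\<in>X. \<Sum>xs\<in>tuples X k. of_bool (hits E (h @ [x]) xs))"
    using Suc.prems E[of h] by (intro add_right_mono mult_left_mono) auto
  finally have "?N * (\<Sum>xs\<in>tuples X (Suc k). of_bool (hits E h xs)) \<le>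
      ?N * (?N ^ k * B) + (\<Sum>x\<in>X. ?N * (\<Sum>xs\<in>tuples X k. of_bool (hits E (h @ [x]) xs)))"
    by (simp add: mult_left_mono flip: sum_distrib_left distrib_left)
  also have "(\<Sum>x\<in>X. ?N * (\<Sum>xs\<in>tuples X k. of_bool (hits E (h @ [x]) xs))) \<le>
      (\<Sum>x\<in>X. real k * B * ?N ^ k)"
    using Suc.prems by (intro sum_mono Suc.IH) auto
  finally show ?case by (simp add: algebra_simps)
qed simp

text \<open>
  A codeword selects the summands of the test point. Doubling \<open>w\<close> keeps the weight even, so that
  odd powers of the Fourier coefficients appear and affine functions get caught.
\<close>

definition codeword :: "nat \<Rightarrow> bit list \<Rightarrow> bit list" where
  "codeword J w = replicate J 1 @ w @ w"

lemma length_codeword: "w \<in> cube m \<Longrightarrow> length (codeword J w) = J + 2 * m"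
  by (simp add: codeword_def cube_def)

lemma codeword_inject: "w \<in> cube m \<Longrightarrow> v \<in> cube m \<Longrightarrow> codeword J w = codeword J v \<longleftrightarrow> w = v"
  by (auto simp: codeword_def cube_def)

text \<open>For even \<open>J\<close> all codewords thus have even weight at least \<open>J\<close>,
  whatever \<open>w\<close> is, as the Fourier bound requires.\<close>

lemma weight_codeword: "weight (codeword J w) = J + 2 * weight w"
  by (simp add: codeword_def weight_def)

definition block_space :: "nat \<Rightarrow> nat \<Rightarrow> nat \<Rightarrow> (bit list list \<times> bit list) set" where
  "block_space n J m = tuples (cube n) (J + 2 * m) \<times> cube m"

definition block_queries :: "nat \<Rightarrow> nat \<Rightarrow> bit list list \<times> bit list \<Rightarrow> bit list list" where
  "block_queries n J \<omega> = (case \<omega> of (xs, w) \<Rightarrow> xs @ [comb n (codeword J w) xs])"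

text \<open>The trailing 1 adds the answer at the test point to the sum of the selected reserve
  answers. An erased answer counts as success, for the sake of 1-sided error.\<close>

definition block_ok :: "nat \<Rightarrow> bit list \<Rightarrow> bit option list \<Rightarrow> bool" where
  "block_ok J w as \<longleftrightarrow> None \<in> set as \<or> dot (codeword J w @ [1]) (map the as) = 0"

lemma finite_block_space [simp]: "finite (block_space n J m)"
  by (simp add: block_space_def)

lemma card_block_space: "card (block_space n J m) = (2 ^ n) ^ (J + 2 * m) * 2 ^ m"
  by (simp add: block_space_def card_tuples card_cartesian_product)

lemma block_queries_in_cube:
  assumes "\<omega> \<in> block_space n J m"
  shows "set (block_queries n J \<omega>) \<subseteq> cube n" "length (block_queries n J \<omega>) = J + 2 * m + 1"
  using assms by (auto simp: block_space_def block_queries_def tuples_def length_codeword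
      intro!: comb_in_cube)

text \<open>Two candidates coincide exactly if the combination given by the sum of their codewords
  vanishes. This sum is nonzero, so the combination is uniform.\<close>

lemma card_comb_codeword_collision:
  assumes "w \<in> cube m" "v \<in> cube m" "w \<noteq> v"
  shows "2 ^ n * (\<Sum>xs\<in>tuples (cube n) (J + 2 * m).
      of_bool (comb n (codeword J w) xs = comb n (codeword J v) xs)) = (2 ^ n :: real) ^ (J + 2 * m)"
proof -
  define c where "c = codeword J w"
  define d where "d = codeword J v"
  let ?k = "J + 2 * m"
  have cd: "c \<in> cube ?k" "d \<in> cube ?k" "c \<noteq> d"
    using assms by (auto simp: c_def d_def cube_def length_codeword[unfolded cube_def] 
        codeword_inject[unfolded cube_def])
  then have e: "length (bitwise_xor c d) = ?k"
    using bitwise_xor_in_cube[OF cd(1,2)] by (simp add: cube_def)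
  have "bitwise_xor c d \<noteq> zeros ?k"
    using cd by (simp add: bitwise_xor_eq_iff[where n = ?k])
  then have *: "2 ^ n * card {xs \<in> tuples (cube n) ?k. comb n (bitwise_xor c d) xs = zeros n} = (2 ^ n) ^ ?k"
    using card_comb_eq[of "bitwise_xor c d" "zeros n" n] e by simp
  have "{xs \<in> tuples (cube n) ?k. comb n c xs = comb n d xs} =
      {xs \<in> tuples (cube n) ?k. comb n (bitwise_xor c d) xs = zeros n}"
  proof (rule Collect_cong, rule conj_cong)
    fix xs assume xs: "xs \<in> tuples (cube n) ?k"
    have "length c = ?k" "length d = ?k" using cd by (auto simp: cube_def)
    then have "comb n c xs \<in> cube n" "comb n d xs \<in> cube n"
      "comb n (bitwise_xor c d) xs = bitwise_xor (comb n c xs) (comb n d xs)"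
      using xs by (auto simp: comb_add)
    then show "comb n c xs = comb n d xs \<longleftrightarrow> comb n (bitwise_xor c d) xs = zeros n"
      by (simp add: bitwise_xor_eq_iff[where n = n])
  qed simp
  with * have "real (2 ^ n * card {xs \<in> tuples (cube n) ?k. comb n c xs = comb n d xs}) = (2 ^ n) ^ ?k"
    by simp
  then show ?thesis
    by (simp add: sum_of_bool_card c_def d_def Int_def)
qed

text \<open>Birthday bound: a union bound over ordered pairs of distinct indices.\<close>

lemma sum_of_bool_not_inj_le:
  "2 ^ n * (\<Sum>xs\<in>tuples (cube n) (J + 2 * m).
      of_bool (\<not> inj_on (\<lambda>w. comb n (codeword J w) xs) (cube m)))
    \<le> (2 ^ m * (2 ^ m - 1)) * (2 ^ n :: real) ^ (J + 2 * m)"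
proof -
  let ?k = "J + 2 * m" and ?y = "\<lambda>xs w. comb n (codeword J w) xs"
  have "(\<Sum>xs\<in>tuples (cube n) ?k. of_bool (\<not> inj_on (?y xs) (cube m))) \<le>
      (\<Sum>xs\<in>tuples (cube n) ?k. \<Sum>w\<in>cube m. \<Sum>v\<in>cube m - {w}. of_bool (?y xs w = ?y xs v) :: real)"
  proof (rule sum_mono)
    fix xs
    show "of_bool (\<not> inj_on (?y xs) (cube m)) \<le>
        (\<Sum>w\<in>cube m. \<Sum>v\<in>cube m - {w}. of_bool (?y xs w = ?y xs v) :: real)"
    proof (cases "inj_on (?y xs) (cube m)")
      case True
      then show ?thesis by (simp add: sum_nonneg)
    next
      case False
      then obtain w v where wv: "w \<in> cube m" "v \<in> cube m - {w}" "?y xs w = ?y xs v"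
        by (auto simp: inj_on_def)
      have "1 = (of_bool (?y xs w = ?y xs v) :: real)" using wv by simp
      also have "\<dots> \<le> (\<Sum>v\<in>cube m - {w}. of_bool (?y xs w = ?y xs v))"
        using wv by (intro member_le_sum) auto
      also have "\<dots> \<le> (\<Sum>w\<in>cube m. \<Sum>v\<in>cube m - {w}. of_bool (?y xs w = ?y xs v))"
        using wv(1) by (intro member_le_sum[of w "cube m" "\<lambda>w. \<Sum>v\<in>cube m - {w}. of_bool (?y xs w = ?y xs v)"])
          (auto intro: sum_nonneg)
      finally show ?thesis using False by simp
    qed
  qed
  also have "\<dots> = (\<Sum>w\<in>cube m. \<Sum>v\<in>cube m - {w}. \<Sum>xs\<in>tuples (cube n) ?k. of_bool (?y xs w = ?y xs v))"
    by (subst sum.swap, rule sum.cong[OF refl], subst sum.swap) simp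
  finally have "2 ^ n * (\<Sum>xs\<in>tuples (cube n) ?k. of_bool (\<not> inj_on (?y xs) (cube m))) \<le>
      2 ^ n * (\<Sum>w\<in>cube m. \<Sum>v\<in>cube m - {w}.
        \<Sum>xs\<in>tuples (cube n) ?k. of_bool (?y xs w = ?y xs v) :: real)"
    by (rule mult_left_mono) simp
  also have "\<dots> = (\<Sum>w\<in>cube m. \<Sum>v\<in>cube m - {w}.
        2 ^ n * (\<Sum>xs\<in>tuples (cube n) ?k. of_bool (?y xs w = ?y xs v)))"
    unfolding sum_distrib_left ..
  also have "\<dots> = (\<Sum>w\<in>cube m. \<Sum>v\<in>cube m - {w}. (2 ^ n) ^ ?k)"
    by (intro sum.cong refl card_comb_codeword_collision) auto
  also have "\<dots> = (2 ^ m * (2 ^ m - 1)) * (2 ^ n) ^ ?k"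
    by (simp add: of_nat_diff)
  finally show ?thesis .
qed

text \<open>The terms account, in this order, for a manipulated reserve point, for a manipulated
  test point among distinct candidates, and for a collision of candidates. The factor
  \<open>2 ^ m - 1\<close> makes the last term vanish for \<open>m = 0\<close>, which matters if
  \<open>n\<close> is small and the budget tiny.\<close>

definition hit_bound :: "nat \<Rightarrow> nat \<Rightarrow> nat \<Rightarrow> real \<Rightarrow> real" where
  "hit_bound n J m B = real (J + 2 * m) * B / 2 ^ n + B / 2 ^ m + 2 ^ m * (2 ^ m - 1) / 2 ^ n"

text \<open>
  Once the reserve \<open>xs\<close> has pairwise distinct candidate test points, the adversary can spoil only
  a \<open>B / 2 ^ m\<close> fraction of them before learning which one is asked.
\<close>

lemma sum_of_bool_block_hits_le:
  assumes E: "\<And>g. g \<in> lists (cube n) \<Longrightarrow> length g \<le> l \<Longrightarrow> real (card (cube n \<inter> E g)) \<le> B"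
    and B: "0 \<le> B" and h: "h \<in> lists (cube n)" "length h + (J + 2 * m) \<le> l"
  shows "(\<Sum>\<omega>\<in>block_space n J m. of_bool (hits E h (block_queries n J \<omega>)))
    \<le> real (card (block_space n J m)) * hit_bound n J m B"
proof -
  let ?k = "J + 2 * m" and ?y = "\<lambda>xs w. comb n (codeword J w) xs"
  let ?N = "2 ^ n :: real" and ?M = "2 ^ m :: real"
  let ?X = "tuples (cube n) ?k"
  define H where "H = (\<Sum>xs\<in>?X. of_bool (hits E h xs) :: real)"
  define I where "I = (\<Sum>xs\<in>?X. of_bool (\<not> inj_on (?y xs) (cube m)) :: real)"
  have test: "(\<Sum>w\<in>cube m. of_bool (?y xs w \<in> E (h @ xs))) \<le>
      B + ?M * of_bool (\<not> inj_on (?y xs) (cube m))" if xs: "xs \<in> ?X" for xs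
  proof (cases "inj_on (?y xs) (cube m)")
    case True
    have y: "?y xs w \<in> cube n" if "w \<in> cube m" for w
      using that xs by (simp add: length_codeword)
    have "(\<Sum>w\<in>cube m. of_bool (?y xs w \<in> E (h @ xs))) = real (card {w \<in> cube m. ?y xs w \<in> E (h @ xs)})"
      by (simp add: sum_of_bool_card Int_def)
    \<comment> \<open>Distinct candidates inject the bad indices into the manipulated
      points.\<close>
    also have "card {w \<in> cube m. ?y xs w \<in> E (h @ xs)} \<le> card (cube n \<inter> E (h @ xs))"
      using True y by (intro card_inj_on_le[of "?y xs"]) (auto intro: inj_on_subset)
    also have "real (card (cube n \<inter> E (h @ xs))) \<le> B"
      using h xs by (intro E) (auto simp: tuples_def)
    finally show ?thesis using True by simp
  next
    case False
    have "(\<Sum>w\<in>cube m. of_bool (?y xs w \<in> E (h @ xs))) \<le> (\<Sum>w\<in>cube m. 1 :: real)"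
      by (intro sum_mono) auto
    also have "\<dots> = 2 ^ m" by simp
    finally show ?thesis using False B by (simp del: sum_of_bool_eq)
  qed
  have "(\<Sum>\<omega>\<in>block_space n J m. of_bool (hits E h (block_queries n J \<omega>))) =
      (\<Sum>xs\<in>?X. \<Sum>w\<in>cube m. of_bool (hits E h xs \<or> ?y xs w \<in> E (h @ xs)) :: real)"
    by (simp add: block_space_def block_queries_def hits_append sum.cartesian_product
        case_prod_unfold)
  also have "\<dots> \<le> (\<Sum>xs\<in>?X. \<Sum>w\<in>cube m. of_bool (hits E h xs) + of_bool (?y xs w \<in> E (h @ xs)))"
    by (intro sum_mono) auto
  also have "\<dots> = (\<Sum>xs\<in>?X. ?M * of_bool (hits E h xs) + (\<Sum>w\<in>cube m. of_bool (?y xs w \<in> E (h @ xs))))"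
    by (simp add: sum.distrib)
  also have "\<dots> \<le> (\<Sum>xs\<in>?X. ?M * of_bool (hits E h xs) + (B + ?M * of_bool (\<not> inj_on (?y xs) (cube m))))"
    by (intro sum_mono add_left_mono test)
  also have "\<dots> = ?M * H + ?N ^ ?k * B + ?M * I"
    by (simp add: H_def I_def sum.distrib card_tuples flip: sum_distrib_left)
  also have "\<dots> \<le> ?M * (real ?k * B * ?N ^ ?k / ?N) + ?N ^ ?k * B + ?M * (?M * (?M - 1) * ?N ^ ?k / ?N)"
  proof -
    have "?N * H \<le> real ?k * B * ?N ^ ?k"
      using sum_of_bool_hits_le[where X = "cube n" and E = E and h = h and k = ?k and B = B and l = l] E h
      by (simp add: H_def)
    moreover have "?N * I \<le> ?M * (?M - 1) * ?N ^ ?k"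
      using sum_of_bool_not_inj_le[of n J m] by (simp add: I_def)
    ultimately have "H \<le> real ?k * B * ?N ^ ?k / ?N" "I \<le> ?M * (?M - 1) * ?N ^ ?k / ?N"
      by (simp_all add: field_simps)
    then show ?thesis by (intro add_mono mult_left_mono) auto
  qed
  also have "\<dots> = real (card (block_space n J m)) * hit_bound n J m B"
    unfolding card_block_space hit_bound_def by (simp add: field_simps)
  finally show ?thesis .
qed

section \<open>Acceptance of a block whose answers are all genuine\<close>

definition block_check :: "nat \<Rightarrow> nat \<Rightarrow> (bit list \<Rightarrow> bit) \<Rightarrow> bit list list \<times> bit list \<Rightarrow> bool" where
  "block_check n J f \<omega> =
     (case \<omega> of (xs, w) \<Rightarrow> f (comb n (codeword J w) xs) = dot (codeword J w) (map f xs))"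

lemma block_ok_answers:
  assumes "(xs, w) \<in> block_space n J m"
  shows "block_ok J w (map (\<lambda>q. Some (f q)) (block_queries n J (xs, w))) \<longleftrightarrow> block_check n J f (xs, w)"
proof -
  have "length (codeword J w) = length (map f xs)"
    using assms by (auto simp: block_space_def tuples_def length_codeword)
  moreover have "a + b = 0 \<longleftrightarrow> b = a" for a b :: bit
    by (cases a; cases b) simp_all
  ultimately show ?thesis
    by (auto simp: block_ok_def block_queries_def block_check_def comp_def dot_append)
qed

lemma block_check_linear:
  "f \<in> linear_functions n \<Longrightarrow> \<omega> \<in> block_space n J m \<Longrightarrow> block_check n J f \<omega>"
  by (auto simp: block_space_def block_check_def linear_comb length_codeword)

text \<open>For each fixed \<open>w\<close> the check passes with probability
  \<open>(1 + bias) / 2\<close>, and the bound on the bias is uniform in \<open>w\<close>.\<close>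

lemma card_block_check_far:
  assumes far: "far_from (cube n) \<epsilon> (linear_functions n) f" and \<epsilon>: "0 < \<epsilon>" "\<epsilon> \<le> 1 / 2"
    and J: "even J" "Suc j \<le> J"
  shows "real (card {\<omega> \<in> block_space n J m. block_check n J f \<omega>})
    \<le> real (card (block_space n J m)) * ((1 + (1 - 2 * \<epsilon>) ^ j) / 2)"
proof -
  let ?k = "J + 2 * m" and ?p = "(1 - 2 * \<epsilon>) ^ j"
  have sgn: "of_bool (a = b) = (1 + bsign a * bsign b) / 2" for a b
    by (cases a; cases b) simp_all
  have "real (card {\<omega> \<in> block_space n J m. block_check n J f \<omega>}) =
      (\<Sum>\<omega>\<in>block_space n J m. of_bool (block_check n J f \<omega>))"
    by (simp add: sum_of_bool_card Int_def)
  also have "\<dots> = (\<Sum>w\<in>cube m. \<Sum>xs\<in>tuples (cube n) ?k.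
      of_bool (f (comb n (codeword J w) xs) = dot (codeword J w) (map f xs)))"
    by (subst sum.swap)
      (simp add: block_space_def block_check_def sum.cartesian_product case_prod_unfold
        del: sum_of_bool_eq)
  also have "\<dots> = (\<Sum>w\<in>cube m. ((2 ^ n) ^ ?k + (\<Sum>xs\<in>tuples (cube n) ?k.
      bsign (f (comb n (codeword J w) xs)) * bsign (dot (codeword J w) (map f xs)))) / 2)"
    unfolding sgn by (simp add: sum.distrib card_tuples flip: sum_divide_distrib)
  also have "\<dots> \<le> (\<Sum>w\<in>cube m. ((2 ^ n) ^ ?k + (2 ^ n) ^ ?k * ?p) / 2)"
  proof (intro sum_mono divide_right_mono add_left_mono)
    fix w assume "w \<in> cube m"
    then show "(\<Sum>xs\<in>tuples (cube n) ?k. bsign (f (comb n (codeword J w) xs)) *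
        bsign (dot (codeword J w) (map f xs))) \<le> (2 ^ n) ^ ?k * ?p"
      using sum_sign_comb_far[OF far \<epsilon>, of "codeword J w" j] J
      by (simp add: length_codeword weight_codeword)
  qed simp
  also have "\<dots> = real (card (block_space n J m)) * ((1 + ?p) / 2)"
    by (simp add: card_block_space algebra_simps)
  finally show ?thesis .
qed

section \<open>The tester\<close>

text \<open>One block is only guaranteed to reject with probability near 1/2; two blocks square the
  bound on acceptance. Drawing both in advance is harmless, because the strategy sees only the
  queries made so far.\<close>

definition two_blocks :: "nat \<Rightarrow> nat \<Rightarrow>
    (bit list list \<times> bit list) \<times> (bit list list \<times> bit list) \<Rightarrow> (bit list, bit) algorithm" where
  "two_blocks n J p = (case p of (\<omega>, \<psi>) \<Rightarrow>
     ask (block_queries n J \<omega>) (\<lambda>as. ask (block_queries n J \<psi>) (\<lambda>bs.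
       Decide (block_ok J (snd \<omega>) as \<and> block_ok J (snd \<psi>) bs))))"

definition tester :: "nat \<Rightarrow> nat \<Rightarrow> nat \<Rightarrow> (bit list, bit) algorithm pmf" where
  "tester n J m = map_pmf (two_blocks n J) (pmf_of_set (block_space n J m \<times> block_space n J m))"

lemma block_space_nonempty [simp]: "block_space n J m \<noteq> {}"
  using card_block_space[of n J m] by auto

lemma set_pmf_tester:
  "set_pmf (tester n J m) = two_blocks n J ` (block_space n J m \<times> block_space n J m)"
  by (simp add: tester_def)

lemma prob_tester:
  "measure_pmf.prob (tester n J m) {A. P A} =
    real (card {p \<in> block_space n J m \<times> block_space n J m. P (two_blocks n J p)}) /
    (real (card (block_space n J m)))\<^sup>2"
  by (simp add: tester_def measure_pmf_of_set card_cartesian_product power2_eq_square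
      vimage_def Int_def)

lemma accepts_two_blocks:
  "accepts \<sigma> (two_blocks n J (\<omega>, \<psi>)) \<longleftrightarrow>
    block_ok J (snd \<omega>) (answers \<sigma> [] (block_queries n J \<omega>)) \<and>
    block_ok J (snd \<psi>) (answers \<sigma> (block_queries n J \<omega>) (block_queries n J \<psi>))"
  by (simp add: accepts_def two_blocks_def run_from_ask)

text \<open>Either a block sees an erasure and passes by convention, or its answers are values of
  \<open>f\<close>, which pass every check if \<open>f\<close> is linear.\<close>

lemma tester_one_sided:
  "one_sided (linear_functions n) (erasure_adversary (cube n) t) (tester n J m)"
  unfolding one_sided_def set_pmf_tester
proof (intro allI impI ballI)
  fix f \<sigma> A
  assume adv: "erasure_adversary (cube n) t f \<sigma>" and f: "f \<in> linear_functions n"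
    and "A \<in> two_blocks n J ` (block_space n J m \<times> block_space n J m)"
  then obtain \<omega> \<psi> where \<omega>: "\<omega> \<in> block_space n J m" and \<psi>: "\<psi> \<in> block_space n J m"
    and A: "A = two_blocks n J (\<omega>, \<psi>)"
    by auto
  have "block_ok J (snd \<phi>) (answers \<sigma> h (block_queries n J \<phi>))"
    if \<phi>: "\<phi> \<in> block_space n J m" and h: "h \<in> lists (cube n)" for \<phi> h
  proof (cases "None \<in> set (answers \<sigma> h (block_queries n J \<phi>))")
    case True
    then show ?thesis by (simp add: block_ok_def)
  next
    case False
    from answers_erasure_adversary[OF adv h block_queries_in_cube(1)[OF \<phi>] False]
    show ?thesis
      using block_ok_answers[of "fst \<phi>" "snd \<phi>" n J m f] block_check_linear[OF f \<phi>] \<phi> by simp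
  qed
  from this[OF \<omega>, of "[]"] this[OF \<psi>, of "block_queries n J \<omega>"]
  show "accepts \<sigma> A"
    using block_queries_in_cube(1)[OF \<omega>] by (auto simp: A accepts_two_blocks)
qed

lemma queries_tester:
  assumes "A \<in> set_pmf (tester n J m)" shows "queries A \<subseteq> cube n"
proof -
  obtain \<omega> \<psi> where *: "\<omega> \<in> block_space n J m" "\<psi> \<in> block_space n J m" "A = two_blocks n J (\<omega>, \<psi>)"
    using assms by (auto simp: set_pmf_tester)
  show ?thesis
    unfolding * two_blocks_def prod.case
    by (intro queries_ask_subset *(1,2)[THEN block_queries_in_cube(1)]) simp
qed

lemma makes_at_most_tester:
  assumes "A \<in> set_pmf (tester n J m)" shows "makes_at_most A (2 * (J + 2 * m + 1))"
proof -
  obtain \<omega> \<psi> where *: "\<omega> \<in> block_space n J m" "\<psi> \<in> block_space n J m" "A = two_blocks n J (\<omega>, \<psi>)"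
    using assms by (auto simp: set_pmf_tester)
  have "makes_at_most A (length (block_queries n J \<omega>) + (length (block_queries n J \<psi>) + 0))"
    unfolding * two_blocks_def prod.case by (intro makes_at_most_ask) simp
  then show ?thesis using *(1,2)[THEN block_queries_in_cube(2)] by (simp add: algebra_simps)
qed

text \<open>Union bound over the two blocks; for each fixed first block, its queries form the
  starting history of the second. The cap on the length of histories covers both blocks.\<close>

lemma sum_of_bool_two_blocks_hits_le:
  assumes E: "\<And>g. g \<in> lists (cube n) \<Longrightarrow> length g \<le> 2 * (J + 2 * m + 1) \<Longrightarrow>
      real (card (cube n \<inter> E g)) \<le> B" and B: "0 \<le> B"
  shows "real (card {(\<omega>, \<psi>) \<in> block_space n J m \<times> block_space n J m.
      hits E [] (block_queries n J \<omega> @ block_queries n J \<psi>)})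
    \<le> (real (card (block_space n J m)))\<^sup>2 * (2 * hit_bound n J m B)"
proof -
  let ?\<Omega> = "block_space n J m" and ?q = "block_queries n J"
  let ?b = "real (card ?\<Omega>) * hit_bound n J m B"
  have "real (card {(\<omega>, \<psi>) \<in> ?\<Omega> \<times> ?\<Omega>. hits E [] (?q \<omega> @ ?q \<psi>)}) =
      (\<Sum>p\<in>?\<Omega> \<times> ?\<Omega>. of_bool (hits E [] (?q (fst p) @ ?q (snd p))))"
    by (subst sum_of_bool_card) (auto intro!: arg_cong[where f = card])
  also have "\<dots> = (\<Sum>\<omega>\<in>?\<Omega>. \<Sum>\<psi>\<in>?\<Omega>. of_bool (hits E [] (?q \<omega>) \<or> hits E (?q \<omega>) (?q \<psi>)))"
    by (simp add: sum.cartesian_product hits_append case_prod_unfold)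
  also have "\<dots> \<le> (\<Sum>\<omega>\<in>?\<Omega>. \<Sum>\<psi>\<in>?\<Omega>. of_bool (hits E [] (?q \<omega>)) + of_bool (hits E (?q \<omega>) (?q \<psi>)))"
    by (intro sum_mono) auto
  also have "\<dots> = real (card ?\<Omega>) * (\<Sum>\<omega>\<in>?\<Omega>. of_bool (hits E [] (?q \<omega>))) +
      (\<Sum>\<omega>\<in>?\<Omega>. \<Sum>\<psi>\<in>?\<Omega>. of_bool (hits E (?q \<omega>) (?q \<psi>)))"
    by (simp add: sum.distrib flip: sum_distrib_left)
  also have "\<dots> \<le> real (card ?\<Omega>) * ?b + (\<Sum>\<omega>\<in>?\<Omega>. ?b)"
  proof (intro add_mono mult_left_mono sum_mono)
    show "(\<Sum>\<omega>\<in>?\<Omega>. of_bool (hits E [] (?q \<omega>))) \<le> ?b"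
      using E B by (intro sum_of_bool_block_hits_le) auto
    show "(\<Sum>\<psi>\<in>?\<Omega>. of_bool (hits E (?q \<omega>) (?q \<psi>))) \<le> ?b" if \<omega>: "\<omega> \<in> ?\<Omega>" for \<omega>
      using E B block_queries_in_cube[OF \<omega>] by (intro sum_of_bool_block_hits_le) auto
  qed simp
  finally show ?thesis by (simp add: power2_eq_square algebra_simps)
qed

text \<open>The abstract \<open>Adv\<close> covers erasures and corruptions at once. An error
  requires a hit, of probability at most \<open>2 * hit_bound\<close>, or, for far \<open>f\<close>,
  that both genuine checks pass, which accounts for the square.\<close>

lemma online_tester_tester:
  assumes Adv: "\<And>f \<sigma>. Adv f \<sigma> \<Longrightarrow> starts_with (cube n) f \<sigma> \<and> budget_managing (cube n) t \<sigma>"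
    and t: "0 \<le> t" and \<epsilon>: "0 < \<epsilon>" "\<epsilon> \<le> 1 / 2" and J: "even J" "Suc j \<le> J"
    and err: "2 * hit_bound n J m (real (2 * (J + 2 * m + 1)) * t) +
      ((1 + (1 - 2 * \<epsilon>) ^ j) / 2)\<^sup>2 \<le> 1 / 3"
  shows "online_tester (cube n) \<epsilon> (linear_functions n) Adv (tester n J m)"
  unfolding online_tester_def
proof (intro conjI allI impI ballI queries_tester)
  fix f \<sigma> assume "Adv f \<sigma>"
  then have start: "starts_with (cube n) f \<sigma>" and budget: "budget_managing (cube n) t \<sigma>"
    using Adv by auto
  let ?\<Omega> = "block_space n J m" and ?q = "block_queries n J" and ?l = "2 * (J + 2 * m + 1)"
  let ?B = "real ?l * t"
  define \<beta> where "\<beta> = hit_bound n J m ?B"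
  define S where "S = (real (card ?\<Omega>))\<^sup>2"
  have "card ?\<Omega> \<noteq> 0" by (simp add: card_block_space)
  then have S: "0 < S" by (simp add: S_def)
  have card_S: "S = real (card (?\<Omega> \<times> ?\<Omega>))"
    by (simp add: S_def power2_eq_square card_cartesian_product)
  \<comment> \<open>The budget bounds the size of this set, and outside it the answers still equal
    \<open>f\<close>.\<close>
  define E where "E h = {x \<in> cube n. \<sigma> [] x \<noteq> \<sigma> h x}" for h
  let ?H = "{(\<omega>, \<psi>) \<in> ?\<Omega> \<times> ?\<Omega>. hits E [] (?q \<omega> @ ?q \<psi>)}"
  have "real (card (cube n \<inter> E g)) \<le> ?B" if "g \<in> lists (cube n)" "length g \<le> ?l" for g
  proof -
    have "cube n \<inter> E g = E g" by (auto simp: E_def)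
    then have "real (card (cube n \<inter> E g)) \<le> real (length g) * t"
      using budget that by (simp add: budget_managing_def hamming_dist_def E_def)
    also have "\<dots> \<le> ?B" using that t by (intro mult_right_mono) auto
    finally show ?thesis .
  qed
  then have H: "real (card ?H) \<le> S * (2 * \<beta>)"
    unfolding S_def \<beta>_def using t by (intro sum_of_bool_two_blocks_hits_le) auto
  have finH: "finite ?H"
    by (rule finite_subset[of _ "?\<Omega> \<times> ?\<Omega>"]) auto
  have unhit: "accepts \<sigma> (two_blocks n J (\<omega>, \<psi>)) \<longleftrightarrow> block_check n J f \<omega> \<and> block_check n J f \<psi>"
    if p: "\<omega> \<in> ?\<Omega>" "\<psi> \<in> ?\<Omega>" and "\<not> hits E [] (?q \<omega> @ ?q \<psi>)" for \<omega> \<psi>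
  proof -
    have "\<not> hits E [] (?q \<omega>)" "\<not> hits E (?q \<omega>) (?q \<psi>)"
      using that by (auto simp: hits_append)
    then have "answers \<sigma> [] (?q \<omega>) = map (\<lambda>q. Some (f q)) (?q \<omega>)"
      "answers \<sigma> (?q \<omega>) (?q \<psi>) = map (\<lambda>q. Some (f q)) (?q \<psi>)"
      using p[THEN block_queries_in_cube(1)] start
      unfolding E_def by (simp_all add: answers_eq_map_Some[of "cube n"])
    then show ?thesis
      using p block_ok_answers[of "fst \<omega>" "snd \<omega>" n J m f] block_ok_answers[of "fst \<psi>" "snd \<psi>" n J m f]
      by (simp add: accepts_two_blocks)
  qed
  {
    assume f: "f \<in> linear_functions n"
    have "?\<Omega> \<times> ?\<Omega> \<subseteq> {p \<in> ?\<Omega> \<times> ?\<Omega>. accepts \<sigma> (two_blocks n J p)} \<union> ?H"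
      using unhit block_check_linear[OF f] by auto
    then have "card (?\<Omega> \<times> ?\<Omega>) \<le> card ({p \<in> ?\<Omega> \<times> ?\<Omega>. accepts \<sigma> (two_blocks n J p)} \<union> ?H)"
      using finH by (intro card_mono) auto
    also have "\<dots> \<le> card {p \<in> ?\<Omega> \<times> ?\<Omega>. accepts \<sigma> (two_blocks n J p)} + card ?H"
      by (rule card_Un_le)
    finally have "S \<le> real (card {p \<in> ?\<Omega> \<times> ?\<Omega>. accepts \<sigma> (two_blocks n J p)}) + S * (2 * \<beta>)"
      unfolding card_S using H[unfolded card_S] by linarith
    then have "1 - 2 * \<beta> \<le> measure_pmf.prob (tester n J m) {A. accepts \<sigma> A}"
      using S by (simp add: prob_tester field_simps flip: S_def)
    moreover have "2 * \<beta> \<le> 1 / 3"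
      using err zero_le_power2[of "(1 + (1 - 2 * \<epsilon>) ^ j) / 2"] unfolding \<beta>_def by linarith
    ultimately show "2 / 3 \<le> measure_pmf.prob (tester n J m) {A. accepts \<sigma> A}"
      by linarith
  }
  {
    assume far: "far_from (cube n) \<epsilon> (linear_functions n) f"
    let ?G = "{\<omega> \<in> ?\<Omega>. block_check n J f \<omega>}" and ?p = "(1 + (1 - 2 * \<epsilon>) ^ j) / 2"
    have "?\<Omega> \<times> ?\<Omega> \<subseteq> {p \<in> ?\<Omega> \<times> ?\<Omega>. \<not> accepts \<sigma> (two_blocks n J p)} \<union> (?H \<union> ?G \<times> ?G)"
      using unhit by auto
    then have "card (?\<Omega> \<times> ?\<Omega>) \<le> card ({p \<in> ?\<Omega> \<times> ?\<Omega>. \<not> accepts \<sigma> (two_blocks n J p)} \<union> (?H \<union> ?G \<times> ?G))"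
      using finH by (intro card_mono) auto
    also have "\<dots> \<le> card {p \<in> ?\<Omega> \<times> ?\<Omega>. \<not> accepts \<sigma> (two_blocks n J p)} + (card ?H + card (?G \<times> ?G))"
      by (meson card_Un_le add_left_mono order_trans)
    finally have "S \<le> real (card {p \<in> ?\<Omega> \<times> ?\<Omega>. \<not> accepts \<sigma> (two_blocks n J p)} +
        (card ?H + card (?G \<times> ?G)))"
      unfolding card_S by (rule of_nat_mono)
    then have "S \<le> real (card {p \<in> ?\<Omega> \<times> ?\<Omega>. \<not> accepts \<sigma> (two_blocks n J p)}) +
        (real (card ?H) + (real (card ?G))\<^sup>2)"
      unfolding power2_eq_square by (simp only: of_nat_add of_nat_mult card_cartesian_product)
    moreover have "(real (card ?G))\<^sup>2 \<le> S * ?p\<^sup>2"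
      unfolding S_def power_mult_distrib[symmetric]
      by (intro power_mono card_block_check_far[OF far \<epsilon> J]) simp
    ultimately have "S * (1 - 2 * \<beta> - ?p\<^sup>2) \<le> real (card {p \<in> ?\<Omega> \<times> ?\<Omega>. \<not> accepts \<sigma> (two_blocks n J p)})"
      using H by (simp add: algebra_simps)
    then have "1 - 2 * \<beta> - ?p\<^sup>2 \<le> measure_pmf.prob (tester n J m) {A. \<not> accepts \<sigma> A}"
      using S by (simp add: prob_tester pos_le_divide_eq mult.commute flip: S_def)
    then show "2 / 3 \<le> measure_pmf.prob (tester n J m) {A. \<not> accepts \<sigma> A}"
      using err unfolding \<beta>_def by linarith
  }
qed

section \<open>Choice of parameters\<close>

text \<open>Take \<open>J = 2 * i\<close> with \<open>i\<close> the ceiling of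
  \<open>8 / \<epsilon>\<close>, and \<open>j = J - 1\<close>. The power is bounded through
  \<open>(1 - 2 * \<epsilon>) * (1 + 2 * \<epsilon>) \<le> 1\<close> and Bernoulli's inequality for
  \<open>1 + 2 * \<epsilon>\<close>.\<close>

lemma exists_reserve_parameter:
  fixes \<epsilon> :: real
  assumes "0 < \<epsilon>" "\<epsilon> \<le> 1 / 2"
  obtains J j where "even J" "Suc j \<le> J" "real J \<le> 17 / \<epsilon>" "(1 - 2 * \<epsilon>) ^ j \<le> 1 / 16"
proof -
  define i where "i = nat \<lceil>8 / \<epsilon>\<rceil>"
  define j where "j = 2 * i - 1"
  have i: "8 / \<epsilon> \<le> real i" "real i \<le> 8 / \<epsilon> + 1"
  proof -
    have "0 < 8 / \<epsilon>" using assms by simp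
    then have "real i = of_int \<lceil>8 / \<epsilon>\<rceil>" unfolding i_def by simp
    then show "8 / \<epsilon> \<le> real i" "real i \<le> 8 / \<epsilon> + 1" by linarith+
  qed
  have "2 \<le> 1 / \<epsilon>" using assms by (simp add: field_simps)
  then have i1: "1 \<le> i" using i by linarith
  then have j: "real j = 2 * real i - 1" by (simp add: j_def of_nat_diff)
  have *: "8 / \<epsilon> \<le> real j" using i j \<open>2 \<le> 1 / \<epsilon>\<close> by linarith
  have "(1 - 2 * \<epsilon>) ^ j * (1 + real j * (2 * \<epsilon>)) \<le> (1 - 2 * \<epsilon>) ^ j * (1 + 2 * \<epsilon>) ^ j"
  proof (rule mult_left_mono)
    show "1 + real j * (2 * \<epsilon>) \<le> (1 + 2 * \<epsilon>) ^ j"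
      using assms by (intro Bernoulli_inequality) simp
    show "0 \<le> (1 - 2 * \<epsilon>) ^ j" using assms by simp
  qed
  also have "\<dots> = (1 - (2 * \<epsilon>)\<^sup>2) ^ j"
  proof -
    have "(1 - 2 * \<epsilon>) * (1 + 2 * \<epsilon>) = 1 - (2 * \<epsilon>)\<^sup>2"
      by (simp add: algebra_simps power2_eq_square)
    then show ?thesis by (simp only: power_mult_distrib[symmetric])
  qed
  also have "\<dots> \<le> 1"
  proof -
    have "(2 * \<epsilon>)\<^sup>2 \<le> 1" by (rule power_le_one) (use assms in simp_all)
    then show ?thesis by (intro power_le_one) simp_all
  qed
  finally have "(1 - 2 * \<epsilon>) ^ j * (1 + real j * (2 * \<epsilon>)) \<le> 1" .
  moreover have "(1 - 2 * \<epsilon>) ^ j * 16 \<le> (1 - 2 * \<epsilon>) ^ j * (1 + real j * (2 * \<epsilon>))"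
  proof (rule mult_left_mono)
    show "16 \<le> 1 + real j * (2 * \<epsilon>)" using * assms by (simp add: pos_divide_le_eq)
    show "0 \<le> (1 - 2 * \<epsilon>) ^ j" using assms by simp
  qed
  ultimately have "(1 - 2 * \<epsilon>) ^ j \<le> 1 / 16" by linarith
  \<comment> \<open>Rounding up costs at most 2, which is at most
    \<open>1 / \<epsilon>\<close>.\<close>
  moreover have "real (2 * i) \<le> 17 / \<epsilon>" using i \<open>2 \<le> 1 / \<epsilon>\<close> by simp
  moreover have "Suc j \<le> 2 * i" using i1 by (simp add: j_def)
  ultimately show thesis by (intro that[of "2 * i" j]) simp_all
qed

text \<open>The least \<open>m\<close> works: if it is positive, \<open>m - 1\<close> fails. The
  case \<open>m = 0\<close> is separate because \<open>A\<close> may be far below 1.\<close>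

lemma exists_power_of_two:
  fixes A :: real
  assumes "0 < A"
  obtains m where "A \<le> 2 ^ m" "m = 0 \<or> 2 ^ m \<le> 2 * A"
proof -
  have "1 < (2::real)" by simp
  from real_arch_pow[OF this] obtain m0 where m0: "A < 2 ^ m0" ..
  define m where "m = (LEAST m. A \<le> 2 ^ m)"
  have "A \<le> 2 ^ m" unfolding m_def by (rule LeastI[of "\<lambda>m. A \<le> 2 ^ m", OF less_imp_le[OF m0]])
  moreover have "2 ^ m \<le> 2 * A" if "m \<noteq> 0"
  proof -
    have "\<not> A \<le> 2 ^ (m - 1)" using that not_less_Least[of "m - 1" "\<lambda>m. A \<le> 2 ^ m"] by (simp flip: m_def)
    then have "2 * 2 ^ (m - 1) \<le> 2 * A" by simp
    then show ?thesis using that by (simp add: power_eq_if)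
  qed
  ultimately show thesis by (intro that[of m]) blast+
qed

text \<open>The lower bound on \<open>2 ^ m\<close>, a large multiple of the total budget, makes the
  test point hard to guess. If \<open>m\<close> is positive, the upper bound makes
  \<open>2 ^ m\<close> a small fraction of \<open>2 ^ (n / 2)\<close>, so that collisions are rare.
  The hypothesis on \<open>L\<^sup>2 * t\<close> leaves room for both.\<close>

lemma hit_bound_le:
  fixes L t :: real
  assumes L: "2 \<le> L" and t: "0 < t" and L2t: "L\<^sup>2 * t \<le> 2 powr (real n / 2) / 2 ^ 20"
    and J: "real J \<le> 17 * L" and m: "real m \<le> 19 / 2 * L"
    and pm: "2 ^ 14 * L * t \<le> 2 ^ m" "m = 0 \<or> 2 ^ m \<le> 2 ^ 15 * L * t"
  shows "hit_bound n J m (real (2 * (J + 2 * m + 1)) * t) \<le> 1 / 100"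
proof -
  define R where "R = 2 powr (real n / 2)"
  have RR: "R * R = 2 ^ n"
    by (simp add: R_def powr_realpow flip: powr_add)
  have R1: "1 \<le> R" by (simp add: R_def ge_one_powr_ge_zero)
  then have RN: "R \<le> 2 ^ n" using mult_left_mono[of 1 R R] by (simp add: RR)
  let ?Q = "real (2 * (J + 2 * m + 1))"
  \<comment> \<open>Here \<open>J \<le> 17 * L\<close>, \<open>2 * m \<le> 19 * L\<close> and
    \<open>1 \<le> L / 2\<close>, and twice the sum is \<open>73 * L\<close>.\<close>
  have Q: "?Q \<le> 73 * L" using assms by simp
  have "real (J + 2 * m) * (?Q * t) \<le> (37 * L) * (73 * L * t)"
    using assms Q by (intro mult_mono) auto
  also have "\<dots> = 2701 * (L\<^sup>2 * t)" by (simp add: power2_eq_square)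
  also have "\<dots> \<le> 2701 * (2 ^ n / 2 ^ 20)"
    using order_trans[OF L2t[folded R_def] divide_right_mono[OF RN]] by (simp add: mult_ac)
  finally have 1: "real (J + 2 * m) * (?Q * t) / 2 ^ n \<le> 2701 / 2 ^ 20"
    by (simp add: field_simps)
  have "?Q * t \<le> 73 * L * t" using Q t by (intro mult_right_mono) auto
  also have "\<dots> \<le> 73 / 2 ^ 14 * 2 ^ m" using pm(1) by simp
  finally have 2: "?Q * t / 2 ^ m \<le> 73 / 2 ^ 14" by (simp add: field_simps)
  have 3: "2 ^ m * (2 ^ m - 1) / 2 ^ n \<le> (1 / 2 ^ 10 :: real)"
  proof (cases "m = 0")
    case False
    \<comment> \<open>As \<open>2 \<le> L\<close>, one factor \<open>L\<close> is traded for a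
      factor 2, so that \<open>2 ^ 15 * L * t\<close> is at most \<open>R / 2 ^ 6\<close>.\<close>
    have "L * t * 2 \<le> L * t * L" using L t by (intro mult_left_mono) auto
    then have "L * t \<le> R / 2 ^ 21" using L2t by (simp add: R_def power2_eq_square mult_ac)
    then have "2 ^ m \<le> R / 2 ^ 6" using pm(2) False by simp
    then have "2 ^ m * (2 ^ m - 1) \<le> R / 2 ^ 6 * (R / 2 ^ 6)"
      using R1 by (intro mult_mono) auto
    also have "\<dots> = 2 ^ n / 2 ^ 12" using RR by simp
    also have "\<dots> \<le> 1 / 2 ^ 10 * 2 ^ n" by simp
    finally show ?thesis by (simp only: pos_divide_le_eq zero_less_power zero_less_numeral)
  qed simp
  show ?thesis unfolding hit_bound_def by (rule order_trans[OF add_mono[OF add_mono[OF 1 2] 3]]) simp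
qed

text \<open>At \<open>t = 1\<close> the logarithm vanishes and the first bound on \<open>t\<close>
  holds for every \<open>n\<close>; the second bound keeps the budget small against
  \<open>2 ^ (n / 2)\<close> there as well.\<close>

theorem theorem1p1:
  shows "\<exists>c>0::real. \<exists>C>0::real. \<forall>(n::nat) (\<epsilon>::real) (t::real).
    0 < \<epsilon> \<and> \<epsilon> \<le> 1 / 2 \<and> 0 < t \<and>
    t * (log 2 t)\<^sup>2 \<le> c * \<epsilon> powr (5 / 2) * 2 powr (real n / 2) \<and>
    t \<le> c * \<epsilon> powr (5 / 2) * 2 powr (real n / 2) \<longrightarrow>
    (\<exists>(T :: (bit list, bit) algorithm pmf) (m::nat).
       online_tester (cube n) \<epsilon> (linear_functions n) (erasure_adversary (cube n) t) T \<and>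
       online_tester (cube n) \<epsilon> (linear_functions n) (corruption_adversary (cube n) t) T \<and>
       one_sided (linear_functions n) (erasure_adversary (cube n) t) T \<and>
       (\<forall>A\<in>set_pmf T. makes_at_most A m) \<and>
       real m \<le> C * max (1 / \<epsilon>) (log 2 t))"
proof (rule exI[of _ "1 / 2 ^ 20"], intro conjI, simp, rule exI[of _ 73], intro conjI, simp,
    intro allI impI, elim conjE)
  fix n :: nat and \<epsilon> t :: real
  assume \<epsilon>: "0 < \<epsilon>" "\<epsilon> \<le> 1 / 2" and t: "0 < t"
    and tlog: "t * (log 2 t)\<^sup>2 \<le> 1 / 2 ^ 20 * \<epsilon> powr (5 / 2) * 2 powr (real n / 2)"
    and tle: "t \<le> 1 / 2 ^ 20 * \<epsilon> powr (5 / 2) * 2 powr (real n / 2)"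
  define R where "R = 2 powr (real n / 2)"
  define L where "L = max (1 / \<epsilon>) (log 2 t)"
  have "2 \<le> 1 / \<epsilon>" using \<epsilon> by (simp add: field_simps)
  then have L: "2 \<le> L" "1 / \<epsilon> \<le> L" "log 2 t \<le> L" by (auto simp: L_def)
  have "0 \<le> R" by (simp add: R_def)
  have \<epsilon>2: "\<epsilon> powr (5 / 2) \<le> \<epsilon>\<^sup>2"
    using powr_mono'[of 2 "5 / 2" \<epsilon>] \<epsilon> by (simp add: powr_numeral)
  also have "\<dots> \<le> 1" using \<epsilon> by (intro power_le_one) auto
  finally have \<epsilon>1: "\<epsilon> powr (5 / 2) \<le> 1" .
  \<comment> \<open>If \<open>1 / \<epsilon>\<close> dominates, the second bound on \<open>t\<close>
    is used with \<open>\<epsilon> powr (5 / 2) \<le> \<epsilon>\<^sup>2\<close>; otherwise the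
    first one with \<open>\<epsilon> powr (5 / 2) \<le> 1\<close>.\<close>
  have L2t: "L\<^sup>2 * t \<le> R / 2 ^ 20"
  proof (cases "log 2 t \<le> 1 / \<epsilon>")
    case True
    have "t \<le> \<epsilon>\<^sup>2 * (R / 2 ^ 20)"
      using order_trans[OF _ mult_right_mono[OF \<epsilon>2, of "R / 2 ^ 20"], of t] tle \<open>0 \<le> R\<close>
      by (simp add: R_def)
    then show ?thesis using True \<epsilon> by (simp add: L_def field_simps power2_eq_square)
  next
    case False
    then show ?thesis
      using order_trans[OF _ mult_right_mono[OF \<epsilon>1, of "R / 2 ^ 20"], of "t * (log 2 t)\<^sup>2"] tlog \<open>0 \<le> R\<close>
      by (simp add: L_def R_def max_def mult.commute)
  qed
  obtain J j where J: "even J" "Suc j \<le> J" "real J \<le> 17 / \<epsilon>" and j: "(1 - 2 * \<epsilon>) ^ j \<le> 1 / 16"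
    using exists_reserve_parameter[OF \<epsilon>] .
  have "0 < 2 ^ 14 * L * t" using L t by simp
  then obtain m where m: "2 ^ 14 * L * t \<le> 2 ^ m" "m = 0 \<or> 2 ^ m \<le> 2 ^ 15 * L * t"
    using exists_power_of_two[of "2 ^ 14 * L * t"] by (auto simp: mult_ac)
  have JL: "real J \<le> 17 * L" using J(3) L(2) by simp
  have mL: "real m \<le> 19 / 2 * L"
  proof (cases "m = 0")
    case False
    \<comment> \<open>Both logarithms below are at most \<open>L\<close>, and
      \<open>15 \<le> 15 / 2 * L\<close> because \<open>2 \<le> L\<close>; together this is
      \<open>19 / 2 * L\<close>.\<close>
    have "real m = log 2 (2 ^ m)" by simp
    also have "\<dots> \<le> log 2 (2 ^ 15 * L * t)" using m(2) False L t by (intro log_mono) auto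
    also have "\<dots> = 15 + log 2 L + log 2 t"
    proof -
      have "log 2 (2 ^ 15) = (15 :: real)" by (subst log_pow_cancel) simp_all
      then show ?thesis using L t by (simp add: log_mult)
    qed
    also have "log 2 L \<le> L"
    proof -
      \<comment> \<open>The tangent bound is applied at \<open>L / 2\<close> to get the slope 1/2,
        which is below \<open>ln 2\<close>.\<close>
      have "ln (L / 2) \<le> L / 2 - 1" using L by (intro ln_le_minus_one) simp
      then have "ln L \<le> L * (1 / 2)" using L ln_2_less_1 by (simp add: ln_div)
      also have "\<dots> \<le> L * ln 2" using L ln2_ge_two_thirds by (intro mult_left_mono) auto
      finally show ?thesis by (simp add: log_def field_simps)
    qed
    finally show ?thesis using L by linarith
  qed (use L in simp)
  define Q where "Q = 2 * (J + 2 * m + 1)"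
  have \<beta>: "hit_bound n J m (real Q * t) \<le> 1 / 100"
    unfolding Q_def using L t L2t JL mL m by (intro hit_bound_le) (auto simp: R_def)
  \<comment> \<open>Here \<open>17 / 32 = (1 + 1 / 16) / 2\<close>. Its square is below 0.29, so
    adding the \<open>2 / 100\<close> for hits stays below 1/3.\<close>
  have "((1 + (1 - 2 * \<epsilon>) ^ j) / 2)\<^sup>2 \<le> (17 / 32)\<^sup>2"
    using j \<epsilon> by (intro power_mono) auto
  with \<beta> have err: "2 * hit_bound n J m (real Q * t) + ((1 + (1 - 2 * \<epsilon>) ^ j) / 2)\<^sup>2 \<le> 1 / 3"
    by (simp add: power2_eq_square)
  have "real Q \<le> 73 * L" using JL mL L by (simp add: Q_def)
  then show "\<exists>(T :: (bit list, bit) algorithm pmf) (m::nat).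
       online_tester (cube n) \<epsilon> (linear_functions n) (erasure_adversary (cube n) t) T \<and>
       online_tester (cube n) \<epsilon> (linear_functions n) (corruption_adversary (cube n) t) T \<and>
       one_sided (linear_functions n) (erasure_adversary (cube n) t) T \<and>
       (\<forall>A\<in>set_pmf T. makes_at_most A m) \<and>
       real m \<le> 73 * max (1 / \<epsilon>) (log 2 t)"
    using t \<epsilon> J err makes_at_most_tester[of _ n J m] tester_one_sided[of n t J m]
    by (intro exI[of _ "tester n J m"] exI[of _ Q] conjI)
      (auto simp: Q_def L_def erasure_adversary_def corruption_adversary_def
        intro!: online_tester_tester)
qed

end
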